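(* Let $p$ and $m$ be positive integers and let $r\in\{0,\ldots,m-1\}$. The automaton $\mathcal{M}_{m,r,\mathcal{T},2^p}$ (defined in the context) is the minimal automaton of the language $\mathrm{val}_{2^p}^{-1}(m\mathcal{T}+r)$.
   Context: Numeration. $A_{2^p}=\{0,\ldots,2^p-1\}$. For $w=c_\ell\cdots c_0\in A_{2^p}^*$, $\mathrm{val}_{2^p}(w)=\sum_j c_j2^{pj}$ (most significant digit first). For $X\subseteq\mathbb{N}$, $\mathrm{val}_{2^p}^{-1}(X)=\{w\in A_{2^p}^*\colon\mathrm{val}_{2^p}(w)\in X\}$. $\mathrm{rep}_{2^p}(n)$ is the usual base-$2^p$ expansion of $n\ge1$ without leading zeroes, and $\mathrm{rep}_{2^p}(0)=\varepsilon$. $\mathcal{T}$ is the set of $n\in\mathbb{N}$ whose binary expansion has an even number of digits $1$; $m\mathcal{T}+r=\{mt+r\colon t\in\mathcal{T}\}$. A DFA is minimal iff it is complete, reduced (distinct states accept distinct languages) and accessible. Let $T,B$ be two symbols with $\overline{T}=B$, $\overline{B}=T$. For $X\in\{T,B\}$ and $n\in\mathbb{N}$, $X_n=X$ if $n\in\mathcal{T}$ and $X_n=\overline{X}$ otherwise. Write $m=k2^z$ with $k$ odd, $R=|\mathrm{rep}_{2^p}(r)|$, $N=\max\{\lceil z/p\rceil,R\}$. The automaton $\Pi=\Pi(\mathcal{A}_{m,r,2^p}\times\mathcal{A}_{\mathcal{T},2^p})$ is the complete DFA over $A_{2^p}$ with state set $\{0,\ldots,m-1\}\times\{T,B\}$,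 initial state $(0,T)$, unique final state $(r,T)$, and a transition labeled $e\in A_{2^p}$ from $(i,X)$ to $(j,Y)$ iff there exists $d\in A_{2^p}$ with $2^pi+e=md+j$ and $Y=X_d$. Classes. For $\alpha\in\{0,\ldots,N\}$ let \[C_\alpha'=\begin{cases}\{(\lfloor\frac{r}{2^{p\alpha}}\rfloor+\ell\frac{m}{2^{p\alpha}},T_\ell)\colon 0\le\ell\le2^{p\alpha}-1\}&\text{if }\alpha\le\frac zp,\\ \{(\lfloor\frac{r}{2^{p\alpha}}\rfloor+\ell k,T_\ell)\colon 0\le\ell\le2^{z}-1\}&\text{if }\alpha\ge\frac zp,\end{cases}\qquad C_\alpha=C_\alpha'\setminus\bigcup_{\beta=0}^{\alpha-1}C_\beta'.\] For $(j,X)\in(\{0,\ldots,k-1\}\times\{T,B\})\setminus\{(0,T)\}$ let \[D_{(j,X)}'=\{(j+\ell k,X_\ell)\colon 0\le\ell\le 2^z-1\},\qquad D_{(j,X)}=D_{(j,X)}'\setminus\bigcup_{\alpha=0}^{N}C_\alpha.\] The nonempty sets among these $C_\alpha$ and $D_{(j,X)}$ partition the state set of $\Pi$. The automaton $\mathcal{M}_{m,r,\mathcal{T},2^p}$ over $A_{2^p}$ has as states the classes $C_\alpha$ ($0\le\alpha\le N$) and the nonempty classes $D_{(j,X)}$; its initial state is $C_R$ (which contains $(0,T)$), its only final state is $C_0=\{(r,T)\}$, and there is a transition labeled $a\in A_{2^p}$ from a class $J_1$ to a class $J_2$ iff in $\Pi$ there is a transition labeled $a$ from some state of $J_1$ to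 some state of $J_2$. *)

theory Defs
  imports Complex_Main "HOL-Computational_Algebra.Primes"
begin

record ('q, 'a) automaton =
  states :: "'q set"
  alphabet :: "'a set"
  initial :: 'q
  finals :: "'q set"
  transitions :: "('q \<times> 'a \<times> 'q) set"

definition dfa :: "('q, 'a) automaton \<Rightarrow> bool" where
  "dfa A \<longleftrightarrow>
     finite (states A) \<and> finite (alphabet A) \<and>
     initial A \<in> states A \<and> finals A \<subseteq> states A \<and>
     transitions A \<subseteq> states A \<times> alphabet A \<times> states A \<and>
     (\<forall>q a q1 q2. (q, a, q1) \<in> transitions A \<longrightarrow> (q, a, q2) \<in> transitions A \<longrightarrow> q1 = q2)"

primrec run :: "('q, 'a) automaton \<Rightarrow> 'q \<Rightarrow> 'a list \<Rightarrow> 'q \<Rightarrow> bool" where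
  "run A q [] q' \<longleftrightarrow> q = q'"
| "run A q (a # w) q' \<longleftrightarrow> (\<exists>q''. (q, a, q'') \<in> transitions A \<and> run A q'' w q')"

definition language_from :: "('q, 'a) automaton \<Rightarrow> 'q \<Rightarrow> 'a list set" where
  "language_from A q = {w. \<exists>f \<in> finals A. run A q w f}"

definition language :: "('q, 'a) automaton \<Rightarrow> 'a list set" where
  "language A = language_from A (initial A)"

definition complete_automaton :: "('q, 'a) automaton \<Rightarrow> bool" where
  "complete_automaton A \<longleftrightarrow> (\<forall>q \<in> states A. \<forall>a \<in> alphabet A. \<exists>q'. (q, a, q') \<in> transitions A)"

definition reduced :: "('q, 'a) automaton \<Rightarrow> bool" where
  "reduced A \<longleftrightarrow>
     (\<forall>q \<in> states A. \<forall>q' \<in> states A. q \<noteq> q' \<longrightarrow> language_from A q \<noteq> language_from A q')"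

definition accessible :: "('q, 'a) automaton \<Rightarrow> bool" where
  "accessible A \<longleftrightarrow> (\<forall>q \<in> states A. \<exists>w. run A (initial A) w q)"

definition minimal_dfa :: "('q, 'a) automaton \<Rightarrow> bool" where
  "minimal_dfa A \<longleftrightarrow> dfa A \<and> complete_automaton A \<and> reduced A \<and> accessible A"

definition minimal_automaton_of :: "('q, 'a) automaton \<Rightarrow> 'a list set \<Rightarrow> bool" where
  "minimal_automaton_of A L \<longleftrightarrow> minimal_dfa A \<and> language A = L"

definition digits :: "nat \<Rightarrow> nat set" where
  "digits b = {0..<b}"

text \<open>Words are lists with the most significant digit first, hence the reversal.\<close>

definition val :: "nat \<Rightarrow> nat list \<Rightarrow> nat" where
  "val b w = (\<Sum>j<length w. rev w ! j * b ^ j)"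

definition val_preimage :: "nat \<Rightarrow> nat set \<Rightarrow> nat list set" where
  "val_preimage b X = {w \<in> lists (digits b). val b w \<in> X}"

text \<open>The test \<open>b < 2\<close> only serves termination; bases are at least 2.\<close>

fun rep :: "nat \<Rightarrow> nat \<Rightarrow> nat list" where
  "rep b n = (if b < 2 \<or> n = 0 then [] else rep b (n div b) @ [n mod b])"

declare rep.simps [simp del]

definition thue_morse :: "nat set" where
  "thue_morse = {n. even (count_list (rep 2 n) 1)}"

datatype letter = T | B

primrec opposite :: "letter \<Rightarrow> letter" where
  "opposite T = B"
| "opposite B = T"

definition twist :: "letter \<Rightarrow> nat \<Rightarrow> letter" where
  "twist X n = (if n \<in> thue_morse then X else opposite X)"

definition Pi_aut :: "nat \<Rightarrow> nat \<Rightarrow> nat \<Rightarrow> (nat \<times> letter, nat) automaton" where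
  "Pi_aut p m r =
    \<lparr> states = {0..<m} \<times> {T, B},
      alphabet = digits (2 ^ p),
      initial = (0, T),
      finals = {(r, T)},
      transitions = {((i, X), e, (j, Y)) | i X e j Y.
        i \<in> {0..<m} \<and> j \<in> {0..<m} \<and> e \<in> digits (2 ^ p) \<and>
        (\<exists>d \<in> digits (2 ^ p). 2 ^ p * i + e = m * d + j \<and> Y = twist X d)} \<rparr>"

text \<open>For \<open>m > 0\<close>, these are the \<open>z\<close> and the odd \<open>k\<close> with \<open>m = k * 2 ^ z\<close>.\<close>

definition two_exp :: "nat \<Rightarrow> nat" where
  "two_exp m = multiplicity 2 m"

definition odd_part :: "nat \<Rightarrow> nat" where
  "odd_part m = m div 2 ^ two_exp m"

definition rep_len :: "nat \<Rightarrow> nat \<Rightarrow> nat" where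
  "rep_len p r = length (rep (2 ^ p) r)"

definition max_index :: "nat \<Rightarrow> nat \<Rightarrow> nat \<Rightarrow> nat" where
  "max_index p m r = max (nat \<lceil>real (two_exp m) / real p\<rceil>) (rep_len p r)"

text \<open>In the first case below, \<open>2 ^ (p * \<alpha>)\<close> divides \<open>m\<close>, so that
  \<open>m div 2 ^ (p * \<alpha>)\<close> is an exact quotient.\<close>

definition C_pre :: "nat \<Rightarrow> nat \<Rightarrow> nat \<Rightarrow> nat \<Rightarrow> (nat \<times> letter) set" where
  "C_pre p m r \<alpha> =
    (if real \<alpha> \<le> real (two_exp m) / real p
     then {(r div 2 ^ (p * \<alpha>) + l * (m div 2 ^ (p * \<alpha>)), twist T l) | l. l < 2 ^ (p * \<alpha>)}
     else {(r div 2 ^ (p * \<alpha>) + l * odd_part m, twist T l) | l. l < 2 ^ two_exp m})"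

definition C_class :: "nat \<Rightarrow> nat \<Rightarrow> nat \<Rightarrow> nat \<Rightarrow> (nat \<times> letter) set" where
  "C_class p m r \<alpha> = C_pre p m r \<alpha> - (\<Union>\<beta><\<alpha>. C_pre p m r \<beta>)"

definition D_pre :: "nat \<Rightarrow> nat \<times> letter \<Rightarrow> (nat \<times> letter) set" where
  "D_pre m = (\<lambda>(j, X). {(j + l * odd_part m, twist X l) | l. l < 2 ^ two_exp m})"

definition D_class :: "nat \<Rightarrow> nat \<Rightarrow> nat \<Rightarrow> nat \<times> letter \<Rightarrow> (nat \<times> letter) set" where
  "D_class p m r q = D_pre m q - (\<Union>\<alpha>\<le>max_index p m r. C_class p m r \<alpha>)"

definition D_indices :: "nat \<Rightarrow> (nat \<times> letter) set" where
  "D_indices m = ({0..<odd_part m} \<times> {T, B}) - {(0, T)}"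

definition classes :: "nat \<Rightarrow> nat \<Rightarrow> nat \<Rightarrow> (nat \<times> letter) set set" where
  "classes p m r =
     {C_class p m r \<alpha> | \<alpha>. \<alpha> \<le> max_index p m r} \<union>
     {D_class p m r q | q. q \<in> D_indices m \<and> D_class p m r q \<noteq> {}}"

definition M_aut :: "nat \<Rightarrow> nat \<Rightarrow> nat \<Rightarrow> ((nat \<times> letter) set, nat) automaton" where
  "M_aut p m r =
    \<lparr> states = classes p m r,
      alphabet = digits (2 ^ p),
      initial = C_class p m r (rep_len p r),
      finals = {C_class p m r 0},
      transitions = {(J1, a, J2) | J1 a J2.
        J1 \<in> classes p m r \<and> J2 \<in> classes p m r \<and> a \<in> digits (2 ^ p) \<and>
        (\<exists>q1 \<in> J1. \<exists>q2 \<in> J2. (q1, a, q2) \<in> transitions (Pi_aut p m r))} \<rparr>"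

end

theory Submission
  imports Defs "HOL-Number_Theory.Cong"
begin

text \<open>From the state \<open>(i, X)\<close> of the product automaton, a word of length \<open>n\<close> and value \<open>v\<close> is accepted
  iff \<open>2 ^ (p * n) * i + v = m * d + r\<close> for some \<open>d\<close> with \<open>twist X d = T\<close>. Dividing by \<open>2 ^ (p * n)\<close>
  shows that, as long as \<open>p * n \<le> z\<close>, the state accepts a word of length \<open>n\<close> iff it lies in \<open>C'\<^sub>n\<close>, and
  that longer words do not separate the elements of \<open>C'\<^sub>n\<close>. Words with \<open>p * n \<ge> z\<close> do not
  separate the elements of one \<open>D'(j, X)\<close> either, whereas two distinct such sets share no accepted
  word of this length because \<open>k\<close> is odd. Hence the classes are exactly the Nerode classes of the
  product automaton.\<close>

subsection \<open>Quotients of automata\<close>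

lemma language_from_Nil: "[] \<in> language_from A q \<longleftrightarrow> q \<in> finals A"
  by (auto simp: language_from_def)

lemma language_from_Cons:
  "a # w \<in> language_from A q \<longleftrightarrow> (\<exists>q'. (q, a, q') \<in> transitions A \<and> w \<in> language_from A q')"
  by (auto simp: language_from_def)

lemma dfa_language_from_Cons:
  assumes "dfa A" and "(q, a, q') \<in> transitions A"
  shows "a # w \<in> language_from A q \<longleftrightarrow> w \<in> language_from A q'"
  using assms unfolding language_from_Cons dfa_def by blast

text \<open>The transitions of \<open>M\<close> are given only existentially through
  representatives, as in \<open>M_aut\<close>. That they are deterministic and complete is derived
  from the fact that the states of \<open>M\<close> are exactly the classes of states of
  \<open>A\<close> with equal languages.\<close>

locale nerode_quotient =
  fixes A :: "('q, 'a) automaton" and M :: "('q set, 'a) automaton"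
  assumes dfa: "dfa A"
    and complete: "complete_automaton A"
    and accessible: "accessible A"
    and nonempty: "\<And>J. J \<in> states M \<Longrightarrow> J \<noteq> {}"
    and cover: "\<Union> (states M) = states A"
    and same_language: "\<And>J q q'. J \<in> states M \<Longrightarrow> q \<in> J \<Longrightarrow> q' \<in> J
      \<Longrightarrow> language_from A q = language_from A q'"
    and same_class: "\<And>J J' q q'. J \<in> states M \<Longrightarrow> J' \<in> states M \<Longrightarrow> q \<in> J \<Longrightarrow> q' \<in> J'
      \<Longrightarrow> language_from A q = language_from A q' \<Longrightarrow> J = J'"
    and alphabet: "alphabet M = alphabet A"
    and initial: "initial M \<in> states M" "initial A \<in> initial M"
    and finals: "finals M = {J \<in> states M. J \<inter> finals A \<noteq> {}}"
    and transitions: "transitions M = {(J1, a, J2) | J1 a J2.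
        J1 \<in> states M \<and> J2 \<in> states M \<and> a \<in> alphabet A \<and>
        (\<exists>q1 \<in> J1. \<exists>q2 \<in> J2. (q1, a, q2) \<in> transitions A)}"
begin

lemma transition_states:
  assumes "(q, a, q') \<in> transitions A"
  shows "q \<in> states A" "a \<in> alphabet A" "q' \<in> states A"
  using assms dfa unfolding dfa_def by blast+

text \<open>As \<open>A\<close> is deterministic, equality of languages passes from two states to
  their successors under \<open>a\<close>. The class reached therefore does not depend on the
  representative.\<close>

lemma quotient_transition:
  assumes J: "J \<in> states M" "q \<in> J" and t: "(q, a, q') \<in> transitions A"
  shows "(J, a, J') \<in> transitions M \<longleftrightarrow> J' \<in> states M \<and> q' \<in> J'"
proof
  assume "(J, a, J') \<in> transitions M"
  then obtain q1 q2 where J': "J' \<in> states M" and q1: "q1 \<in> J" and q2: "q2 \<in> J'"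
    and t2: "(q1, a, q2) \<in> transitions A"
    unfolding transitions by blast
  have "language_from A q = language_from A q1"
    using same_language J q1 by blast
  then have eq: "language_from A q' = language_from A q2"
    using dfa_language_from_Cons[OF dfa t] dfa_language_from_Cons[OF dfa t2] by blast
  obtain K where K: "K \<in> states M" "q' \<in> K"
    using transition_states(3)[OF t] cover by blast
  then have "K = J'" using same_class[OF K(1) J' K(2) q2 eq] by simp
  then show "J' \<in> states M \<and> q' \<in> J'" using J' K by simp
next
  assume "J' \<in> states M \<and> q' \<in> J'"
  then show "(J, a, J') \<in> transitions M"
    using J t transition_states(2)[OF t] unfolding transitions by blast
qed

lemma ex_transition:
  assumes "q \<in> states A" and "a \<in> alphabet A"
  shows "\<exists>q'. (q, a, q') \<in> transitions A"
  using assms complete unfolding complete_automaton_def by blast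

lemma quotient_run:
  assumes "J \<in> states M" and "q \<in> J"
  shows "run M J w J' \<longleftrightarrow> J' \<in> states M \<and> (\<exists>q' \<in> J'. run A q w q')"
  using assms
proof (induction w arbitrary: J q)
  case Nil
  have "J = J'" if "J' \<in> states M" "q \<in> J'"
    using same_class[OF Nil.prems(1) that(1) Nil.prems(2) that(2)] by simp
  then show ?case using Nil by auto
next
  case (Cons a w)
  show ?case
  proof (cases "a \<in> alphabet A")
    case False
    then have "\<not> run A q (a # w) q'" for q'
      using transition_states(2) by auto
    moreover have "\<not> run M J (a # w) J'"
      using False by (auto simp: transitions)
    ultimately show ?thesis by blast
  next
    case True
    have "q \<in> states A" using Cons.prems cover by blast
    then obtain q1 where t: "(q, a, q1) \<in> transitions A"
      using ex_transition True by blast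
    have det: "(q, a, q') \<in> transitions A \<longleftrightarrow> q' = q1" for q'
      using t dfa unfolding dfa_def by blast
    obtain K where K: "K \<in> states M" "q1 \<in> K"
      using transition_states(3)[OF t] cover by blast
    have "(J, a, K') \<in> transitions M \<longleftrightarrow> K' = K" for K'
      using quotient_transition[OF Cons.prems t] K same_class[of K' K q1 q1] by blast
    then show ?thesis using Cons.IH[OF K] det by simp
  qed
qed

lemma quotient_language_from:
  assumes "J \<in> states M" and "q \<in> J"
  shows "language_from M J = language_from A q"
proof (intro subset_antisym subsetI)
  fix w assume "w \<in> language_from M J"
  then obtain F where F: "F \<in> finals M" "run M J w F" unfolding language_from_def by blast
  then obtain f where f: "F \<in> states M" "f \<in> F" "run A q w f"
    using quotient_run[OF assms] by blast
  \<comment> \<open>Finality means accepting the empty word, so it is constant on a class.\<close>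
  obtain f' where f': "f' \<in> F" "f' \<in> finals A" using F(1) finals by blast
  then have "f \<in> finals A"
    using same_language[OF f(1,2) f'(1)] language_from_Nil[of A f] language_from_Nil[of A f'] by simp
  then show "w \<in> language_from A q" using f(3) unfolding language_from_def by blast
next
  fix w assume "w \<in> language_from A q"
  then obtain f where f: "f \<in> finals A" "run A q w f" unfolding language_from_def by blast
  then have "f \<in> states A" using dfa unfolding dfa_def by blast
  then obtain F where F: "F \<in> states M" "f \<in> F" using cover by blast
  then have "run M J w F" using quotient_run[OF assms] f(2) by blast
  moreover have "F \<in> finals M" using F f(1) finals by blast
  ultimately show "w \<in> language_from M J" unfolding language_from_def by blast
qed

lemma minimal_automaton_of_quotient: "minimal_automaton_of M (language A)"
proof -
  have "dfa M"
    unfolding dfa_def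
  proof (intro conjI allI impI)
    show "finite (states M)" using dfa cover unfolding dfa_def by (metis finite_UnionD)
    show "finite (alphabet M)" using dfa alphabet unfolding dfa_def by simp
    show "initial M \<in> states M" by (rule initial)
    show "finals M \<subseteq> states M" unfolding finals by blast
    show "transitions M \<subseteq> states M \<times> alphabet M \<times> states M"
      unfolding transitions alphabet by blast
    fix J a J1 J2
    assume 1: "(J, a, J1) \<in> transitions M" and 2: "(J, a, J2) \<in> transitions M"
    from 1 obtain q q' where "J \<in> states M" "q \<in> J" "(q, a, q') \<in> transitions A"
      unfolding transitions by blast
    note * = quotient_transition[OF this]
    show "J1 = J2" using 1 2 same_class[of J1 J2 q' q'] unfolding * by blast
  qed
  moreover have "complete_automaton M"
    unfolding complete_automaton_def
  proof (intro ballI)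
    fix J a assume J: "J \<in> states M" and a: "a \<in> alphabet M"
    then obtain q where q: "q \<in> J" using nonempty by blast
    then obtain q' where t: "(q, a, q') \<in> transitions A"
      using J a ex_transition alphabet cover by blast
    then obtain J' where "J' \<in> states M" "q' \<in> J'"
      using transition_states(3)[OF t] cover by blast
    then show "\<exists>J'. (J, a, J') \<in> transitions M"
      using quotient_transition[OF J q t] by blast
  qed
  moreover have "reduced M"
    unfolding reduced_def
    using quotient_language_from nonempty same_class by (metis ex_in_conv)
  moreover have "accessible M"
    unfolding accessible_def
  proof
    fix J assume J: "J \<in> states M"
    then obtain q where q: "q \<in> J" using nonempty by blast
    then obtain w where "run A (initial A) w q"
      using J cover accessible unfolding accessible_def by blast
    then show "\<exists>w. run M (initial M) w J"
      using quotient_run[OF initial] J q by blast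
  qed
  moreover have "language M = language A"
    unfolding language_def by (rule quotient_language_from[OF initial])
  ultimately show ?thesis
    unfolding minimal_automaton_of_def minimal_dfa_def by blast
qed

end

subsection \<open>Expansions and the Thue--Morse set\<close>

lemma val_Nil: "val b [] = 0"
  by (simp add: val_def)

lemma val_Cons: "val b (a # w) = a * b ^ length w + val b w"
  by (simp add: val_def nth_append)

lemma val_less: "w \<in> lists (digits b) \<Longrightarrow> val b w < b ^ length w"
proof (induction w)
  case Nil
  then show ?case by (simp add: val_Nil)
next
  case (Cons a w)
  then have "val b w < b ^ length w" and "Suc a \<le> b"
    by (auto simp: digits_def)
  then have "val b (a # w) < Suc a * b ^ length w"
    by (simp add: val_Cons)
  also have "\<dots> \<le> b * b ^ length w" using \<open>Suc a \<le> b\<close> by (rule mult_right_mono) simp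
  finally show ?case by simp
qed

text \<open>Leading zeroes are allowed, so the length can be prescribed along with the value; both
  enter the acceptance condition of a state.\<close>

lemma ex_word:
  assumes "v < b ^ n"
  shows "\<exists>w \<in> lists (digits b). length w = n \<and> val b w = v"
  using assms
proof (induction n arbitrary: v)
  case 0
  then show ?case by (auto simp: val_Nil)
next
  case (Suc n)
  then have "b ^ n > 0" by (cases "b = 0") auto
  then have "v mod b ^ n < b ^ n" by simp
  from Suc.IH[OF this] obtain w where
    w: "w \<in> lists (digits b)" "length w = n" "val b w = v mod b ^ n" by blast
  have "v div b ^ n \<in> digits b"
    using Suc.prems by (simp add: digits_def less_mult_imp_div_less)
  then show ?case
    using w by (intro bexI[of _ "v div b ^ n # w"]) (auto simp: val_Cons div_mult_mod_eq)
qed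

text \<open>Dropping the last digit divides \<open>n\<close> by \<open>b\<close> and lowers the
  exponent in the comparison by one.\<close>

lemma less_length_rep:
  assumes "b \<ge> 2"
  shows "a < length (rep b n) \<longleftrightarrow> b ^ a \<le> n"
proof (induction n arbitrary: a rule: less_induct)
  case (less n)
  show ?case
  proof (cases "n = 0")
    case True
    then show ?thesis using assms by (simp add: rep.simps[of b 0])
  next
    case False
    then have len: "length (rep b n) = Suc (length (rep b (n div b)))"
      using assms by (subst rep.simps) simp
    show ?thesis
    proof (cases a)
      case 0
      then show ?thesis using len False by simp
    next
      case (Suc a')
      have "a < length (rep b n) \<longleftrightarrow> b ^ a' \<le> n div b"
        using less[of "n div b" a'] False assms len Suc by simp
      also have "\<dots> \<longleftrightarrow> b ^ a \<le> n"
        using assms Suc by (simp add: less_eq_div_iff_mult_less_eq mult.commute)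
      finally show ?thesis .
    qed
  qed
qed

lemma zero_in_thue_morse: "0 \<in> thue_morse"
  by (simp add: thue_morse_def rep.simps[of 2 0])

lemma double_in_thue_morse: "2 * n \<in> thue_morse \<longleftrightarrow> n \<in> thue_morse"
  by (cases "n = 0") (simp_all add: thue_morse_def rep.simps[of 2 "2 * n"])

lemma Suc_double_in_thue_morse: "Suc (2 * n) \<in> thue_morse \<longleftrightarrow> n \<notin> thue_morse"
  by (simp add: thue_morse_def rep.simps[of 2 "Suc (2 * n)"])

lemma one_notin_thue_morse: "Suc 0 \<notin> thue_morse"
  using Suc_double_in_thue_morse[of 0] zero_in_thue_morse by simp

text \<open>The binary expansion of \<open>l\<close> is followed by that of \<open>e\<close>, padded
  to \<open>a\<close> digits, so the parities of the numbers of ones add up. The induction removes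
  the lowest digit of \<open>e\<close>.\<close>

lemma append_in_thue_morse:
  assumes "e < 2 ^ a"
  shows "2 ^ a * l + e \<in> thue_morse \<longleftrightarrow> (l \<in> thue_morse \<longleftrightarrow> e \<in> thue_morse)"
  using assms
proof (induction a arbitrary: e)
  case 0
  then show ?case by (simp add: zero_in_thue_morse)
next
  case (Suc a)
  define f where "f = e div 2"
  have f: "f < 2 ^ a" using Suc.prems by (simp add: f_def)
  consider "e = 2 * f" | "e = Suc (2 * f)"
    unfolding f_def by arith
  then show ?case
  proof cases
    case 1
    have "2 ^ Suc a * l + e = 2 * (2 ^ a * l + f)" using 1 by simp
    then show ?thesis using Suc.IH[OF f] 1 by (simp only: double_in_thue_morse)
  next
    case 2
    have "2 ^ Suc a * l + e = Suc (2 * (2 ^ a * l + f))" using 2 by simp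
    then show ?thesis using Suc.IH[OF f] 2 by (simp only: Suc_double_in_thue_morse) blast
  qed
qed

lemma opposite_opposite [simp]: "opposite (opposite X) = X"
  by (cases X) simp_all

lemma twist_0 [simp]: "twist X 0 = X"
  by (simp add: twist_def zero_in_thue_morse)

lemma twist_1 [simp]: "twist X (Suc 0) = opposite X"
  by (simp add: twist_def one_notin_thue_morse)

lemma twist_twist_same [simp]: "twist (twist X n) n = X"
  by (simp add: twist_def)

lemma twist_inject [simp]: "twist X n = twist Y n \<longleftrightarrow> X = Y"
  by (metis twist_twist_same)

lemma twist_append: "e < 2 ^ a \<Longrightarrow> twist X (2 ^ a * l + e) = twist (twist X l) e"
  by (simp add: twist_def append_in_thue_morse)

lemma twist_T_eq_T: "twist T n = T \<longleftrightarrow> n \<in> thue_morse"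
  by (simp add: twist_def)

subsection \<open>The product automaton\<close>

text \<open>Common shape of \<open>C_pre\<close> and \<open>D_pre\<close>: \<open>n\<close> is the
  step, \<open>2 ^ g\<close> the number of elements, and \<open>q\<close> the base point, which is
  the element for \<open>l = 0\<close>.\<close>

definition fiber :: "nat \<Rightarrow> nat \<Rightarrow> nat \<times> letter \<Rightarrow> (nat \<times> letter) set" where
  "fiber n g q = {(fst q + l * n, twist (snd q) l) | l. l < 2 ^ g}"

locale thue_morse_multiple =
  fixes p k z r :: nat
  assumes p_pos: "p > 0" and odd_k: "odd k" and r_less: "r < k * 2 ^ z"
begin

abbreviation "m \<equiv> k * 2 ^ z"

abbreviation "accepted \<equiv> language_from (Pi_aut p m r)"

lemma k_pos: "k > 0" using odd_k by (rule odd_pos)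

lemma m_pos: "m > 0" using k_pos by simp

text \<open>The numbers \<open>d\<close> and \<open>j\<close> in the definition are the quotient and
  the remainder of a division by \<open>m\<close>; the quotient is automatically a digit because
  \<open>i < m\<close>.\<close>

lemma Pi_transition:
  "((i, X), e, q) \<in> transitions (Pi_aut p m r) \<longleftrightarrow>
    i < m \<and> e \<in> digits (2 ^ p) \<and>
    q = ((2 ^ p * i + e) mod m, twist X ((2 ^ p * i + e) div m))" (is "_ \<longleftrightarrow> ?R")
proof
  assume "((i, X), e, q) \<in> transitions (Pi_aut p m r)"
  then obtain j d where i: "i < m" and j: "j < m" and e: "e \<in> digits (2 ^ p)"
    and eq: "2 ^ p * i + e = m * d + j" and q: "q = (j, twist X d)"
    by (auto simp: Pi_aut_def)
  have "(2 ^ p * i + e) mod m = j" "(2 ^ p * i + e) div m = d"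
    unfolding eq using j m_pos by (simp_all del: mult_pos_pos)
  then show ?R using i e q by simp
next
  assume R: ?R
  then have i: "i < m" and e: "e < 2 ^ p" by (auto simp: digits_def)
  have "2 ^ p * i + e < 2 ^ p * Suc i" using e by simp
  also have "\<dots> \<le> 2 ^ p * m" using i by (intro mult_left_mono) auto
  finally have "(2 ^ p * i + e) div m < 2 ^ p" by (rule less_mult_imp_div_less)
  moreover define d j where "d = (2 ^ p * i + e) div m" and "j = (2 ^ p * i + e) mod m"
  ultimately have "d \<in> digits (2 ^ p)" by (simp add: digits_def)
  moreover have "j < m" unfolding j_def using m_pos by (rule mod_less_divisor)
  moreover have "2 ^ p * i + e = m * d + j"
    unfolding d_def j_def by (rule mult_div_mod_eq[symmetric])
  ultimately show "((i, X), e, q) \<in> transitions (Pi_aut p m r)"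
    using R i unfolding Pi_aut_def d_def[symmetric] j_def[symmetric] by auto
qed

text \<open>Reading a digit is one step of long division by \<open>m\<close>. The digits of the
  quotient are concatenated in base \<open>2 ^ p\<close>, and the twists compose
  accordingly.\<close>

lemma Pi_run:
  assumes "i < m"
  shows "run (Pi_aut p m r) (i, X) w q \<longleftrightarrow> w \<in> lists (digits (2 ^ p)) \<and>
    q = ((2 ^ (p * length w) * i + val (2 ^ p) w) mod m,
         twist X ((2 ^ (p * length w) * i + val (2 ^ p) w) div m))"
  using assms
proof (induction w arbitrary: i X)
  case Nil
  then show ?case by (auto simp: val_Nil)
next
  case (Cons a w)
  define i' d v Q where "i' = (2 ^ p * i + a) mod m" and "d = (2 ^ p * i + a) div m"
    and "v = val (2 ^ p) w" and "Q = (2::nat) ^ (p * length w)"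
  have i': "i' < m" unfolding i'_def using m_pos by (rule mod_less_divisor)
  have "2 ^ p * i + a = m * d + i'"
    unfolding i'_def d_def by (rule mult_div_mod_eq[symmetric])
  then have "Q * (2 ^ p * i + a) = Q * (m * d + i')" by simp
  then have "2 ^ (p * length (a # w)) * i + val (2 ^ p) (a # w) = m * (Q * d) + (Q * i' + v)"
    by (simp add: val_Cons v_def Q_def power_add power_mult algebra_simps)
  then have div: "(2 ^ (p * length (a # w)) * i + val (2 ^ p) (a # w)) div m
        = Q * d + (Q * i' + v) div m"
    and mod: "(2 ^ (p * length (a # w)) * i + val (2 ^ p) (a # w)) mod m = (Q * i' + v) mod m"
    using m_pos by (simp_all only: div_mult_self4 mod_mult_self4)
  \<comment> \<open>The second quotient must fit into \<open>p * length w\<close> binary digits for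
    \<open>twist_append\<close>, hence the bound by \<open>Q\<close>.\<close>
  have tw: "twist X (Q * d + (Q * i' + v) div m) = twist (twist X d) ((Q * i' + v) div m)"
    if "w \<in> lists (digits (2 ^ p))"
  proof -
    have "v < Q" using val_less[OF that] by (simp add: v_def Q_def power_mult)
    then have "Q * i' + v < Q * Suc i'" by simp
    also have "\<dots> \<le> Q * m" using i' by (intro mult_left_mono) auto
    finally have "(Q * i' + v) div m < Q" by (rule less_mult_imp_div_less)
    then show ?thesis unfolding Q_def by (rule twist_append)
  qed
  have run: "run (Pi_aut p m r) (i, X) (a # w) q \<longleftrightarrow>
      a \<in> digits (2 ^ p) \<and> run (Pi_aut p m r) (i', twist X d) w q"
    using Cons.prems by (auto simp: Pi_transition i'_def d_def)
  show ?case
  proof (cases "w \<in> lists (digits (2 ^ p))")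
    case True
    then show ?thesis
      unfolding run Cons.IH[OF i'] div mod tw[OF True] by (auto simp: Q_def v_def)
  next
    case False
    then show ?thesis unfolding run Cons.IH[OF i'] by simp
  qed
qed

lemma accepted_iff:
  assumes "i < m"
  shows "w \<in> accepted (i, X) \<longleftrightarrow> w \<in> lists (digits (2 ^ p)) \<and>
    (2 ^ (p * length w) * i + val (2 ^ p) w) mod m = r \<and>
    twist X ((2 ^ (p * length w) * i + val (2 ^ p) w) div m) = T"
proof -
  have "finals (Pi_aut p m r) = {(r, T)}" by (simp add: Pi_aut_def)
  then show ?thesis
    unfolding language_from_def using Pi_run[OF assms, of X w "(r, T)"] by auto
qed

lemma states_Pi: "states (Pi_aut p m r) = {..<m} \<times> UNIV"
proof -
  have "(UNIV :: letter set) = {T, B}" using letter.exhaust by auto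
  then show ?thesis by (simp add: Pi_aut_def atLeast0LessThan)
qed

lemma dfa_Pi: "dfa (Pi_aut p m r)"
proof -
  have "transitions (Pi_aut p m r) \<subseteq>
      states (Pi_aut p m r) \<times> alphabet (Pi_aut p m r) \<times> states (Pi_aut p m r)"
    by (auto simp: Pi_transition states_Pi m_pos) (auto simp: Pi_aut_def k_pos)
  moreover have "finite (states (Pi_aut p m r))" "finals (Pi_aut p m r) \<subseteq> states (Pi_aut p m r)"
      "initial (Pi_aut p m r) \<in> states (Pi_aut p m r)" "finite (alphabet (Pi_aut p m r))"
    using r_less m_pos by (auto simp: Pi_aut_def digits_def)
  ultimately show ?thesis
    unfolding dfa_def by (auto simp: Pi_transition)
qed

lemma complete_Pi: "complete_automaton (Pi_aut p m r)"
  unfolding complete_automaton_def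
proof (intro ballI)
  fix q a assume "q \<in> states (Pi_aut p m r)" and a: "a \<in> alphabet (Pi_aut p m r)"
  then obtain i X where "q = (i, X)" "i < m" by (auto simp: states_Pi)
  moreover have "a \<in> digits (2 ^ p)" using a by (simp add: Pi_aut_def)
  ultimately show "\<exists>q'. (q, a, q') \<in> transitions (Pi_aut p m r)"
    by (simp add: Pi_transition)
qed

lemma exp_large: "n < 2 ^ (p * n)"
proof -
  have "n < 2 ^ n" by (rule less_exp)
  also have "(2::nat) ^ n \<le> 2 ^ (p * n)" using p_pos by (intro power_increasing) auto
  finally show ?thesis .
qed

lemma accessible_Pi: "accessible (Pi_aut p m r)"
  unfolding accessible_def
proof
  fix q assume "q \<in> states (Pi_aut p m r)"
  then obtain i X where q: "q = (i, X)" and i: "i < m" by (auto simp: states_Pi)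
  \<comment> \<open>A word of value \<open>m * d + i\<close> leads from \<open>(0, T)\<close> to
    \<open>(i, twist T d)\<close>. The quotient 0 yields \<open>T\<close> and the quotient 1 yields
    \<open>B\<close>.\<close>
  define d :: nat where "d = (if X = T then 0 else 1)"
  have d: "twist T d = X" by (cases X) (simp_all add: d_def)
  \<comment> \<open>The value itself serves as a sufficient word length.\<close>
  have "m * d + i < (2 ^ p) ^ (m * d + i)"
    using exp_large[of "m * d + i"] by (simp add: power_mult)
  from ex_word[OF this] obtain w where
    w: "w \<in> lists (digits (2 ^ p))" "val (2 ^ p) w = m * d + i" by blast
  have "(m * d + i) div m = d" "(m * d + i) mod m = i"
    using i m_pos by (simp_all del: mult_pos_pos)
  then have "run (Pi_aut p m r) (0, T) w q"
    using Pi_run[OF m_pos] w d q by simp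
  then show "\<exists>w. run (Pi_aut p m r) (initial (Pi_aut p m r)) w q"
    by (auto simp: Pi_aut_def)
qed

lemma language_Pi:
  "language (Pi_aut p m r) = val_preimage (2 ^ p) ((\<lambda>t. m * t + r) ` thue_morse)"
proof (rule set_eqI)
  fix w
  define v where "v = val (2 ^ p) w"
  have "v mod m = r \<and> v div m \<in> thue_morse \<longleftrightarrow> v \<in> (\<lambda>t. m * t + r) ` thue_morse"
  proof
    assume v: "v mod m = r \<and> v div m \<in> thue_morse"
    have "v = m * (v div m) + v mod m" by (rule mult_div_mod_eq[symmetric])
    then have "v = m * (v div m) + r" using v by (simp only:)
    then show "v \<in> (\<lambda>t. m * t + r) ` thue_morse" using v by (intro image_eqI) blast+
  next
    assume "v \<in> (\<lambda>t. m * t + r) ` thue_morse"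
    then obtain t where t: "t \<in> thue_morse" "v = m * t + r" by blast
    have "v div m = t" "v mod m = r"
      unfolding t(2) using r_less m_pos by (simp_all del: mult_pos_pos)
    then show "v mod m = r \<and> v div m \<in> thue_morse" using t(1) by simp
  qed
  moreover have "initial (Pi_aut p m r) = (0, T)" by (simp add: Pi_aut_def)
  moreover have "w \<in> accepted (0, T) \<longleftrightarrow>
      w \<in> lists (digits (2 ^ p)) \<and> v mod m = r \<and> v div m \<in> thue_morse"
    by (simp add: accepted_iff[OF m_pos] twist_T_eq_T v_def)
  ultimately show "w \<in> language (Pi_aut p m r) \<longleftrightarrow>
      w \<in> val_preimage (2 ^ p) ((\<lambda>t. m * t + r) ` thue_morse)"
    unfolding language_def val_preimage_def v_def by (simp only: mem_Collect_eq)
qed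

subsection \<open>States accepting the same words\<close>

text \<open>Adding \<open>l * n\<close> to the first component increases the quotient by \<open>l\<close> times a power of two that
  exceeds the old quotient, and the sign change this causes is undone by \<open>twist X l\<close>.\<close>

lemma accepted_shift:
  assumes m: "m = n * 2 ^ g" and j: "j < n" and l: "l < 2 ^ g" and g: "g \<le> p * length w"
  shows "w \<in> accepted (j + l * n, twist X l) \<longleftrightarrow> w \<in> accepted (j, X)"
proof (cases "w \<in> lists (digits (2 ^ p))")
  case False
  have "j + l * n < Suc l * n" using j by simp
  also have "\<dots> \<le> 2 ^ g * n" using l by (intro mult_right_mono) auto
  finally have "j + l * n < m" using m by (simp add: mult.commute)
  moreover have "j < m" using calculation by simp
  ultimately show ?thesis using False by (simp add: accepted_iff)
next
  case True
  define v P Q where "v = val (2 ^ p) w" and "P = (2::nat) ^ (p * length w)"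
    and "Q = (2::nat) ^ (p * length w - g)"
  have P: "P = 2 ^ g * Q" using g by (simp add: P_def Q_def flip: power_add)
  have "j + l * n < Suc l * n" using j by simp
  also have "\<dots> \<le> 2 ^ g * n" using l by (intro mult_right_mono) auto
  finally have i: "j + l * n < m" using m by (simp add: mult.commute)
  then have j': "j < m" by simp
  have "v < P" using val_less[OF True] by (simp add: v_def P_def power_mult)
  then have "P * j + v < P * Suc j" by simp
  also have "\<dots> \<le> P * n" using j by (intro mult_left_mono) auto
  also have "\<dots> = Q * m" by (simp add: m P)
  finally have small: "(P * j + v) div m < Q" by (rule less_mult_imp_div_less)
  have "P * (j + l * n) + v = m * (Q * l) + (P * j + v)"
    by (simp add: m P algebra_simps)
  then have "(P * (j + l * n) + v) div m = Q * l + (P * j + v) div m"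
    and mod: "(P * (j + l * n) + v) mod m = (P * j + v) mod m"
    using m_pos by (simp_all only: div_mult_self4 mod_mult_self4)
  then have "twist (twist X l) ((P * (j + l * n) + v) div m)
      = twist (twist X l) (Q * l + (P * j + v) div m)" by simp
  also have "\<dots> = twist X ((P * j + v) div m)"
    using small unfolding Q_def by (simp add: twist_append)
  finally show ?thesis
    using mod unfolding accepted_iff[OF i] accepted_iff[OF j'] P_def v_def by simp
qed

lemma fiber_accepted:
  assumes "m = n * 2 ^ g" and "fst q < n" and "g \<le> p * length w" and "q' \<in> fiber n g q"
  shows "w \<in> accepted q' \<longleftrightarrow> w \<in> accepted q"
  using assms accepted_shift[of n g "fst q" _ w "snd q"] by (auto simp: fiber_def)

text \<open>Modulo the odd number \<open>k\<close> the factor \<open>2 ^ (p * length w)\<close> is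
  invertible, so \<open>w\<close> determines the residue and thus the first component. Then the
  quotients agree, and with them the letters.\<close>

lemma accepted_common_word:
  assumes long: "z \<le> p * length w"
    and q: "fst q < k" "w \<in> accepted q" and q': "fst q' < k" "w \<in> accepted q'"
  shows "q = q'"
proof -
  obtain i X i' X' where qq: "q = (i, X)" "q' = (i', X')" by (metis surj_pair)
  have i: "i < k" and i': "i' < k" using q(1) q'(1) qq by auto
  have "k \<le> m" by simp
  note m = less_le_trans[OF i this] less_le_trans[OF i' this]
  define P v where "P = (2::nat) ^ (p * length w)" and "v = val (2 ^ p) w"
  have a: "(P * i + v) mod m = r" "twist X ((P * i + v) div m) = T"
    and a': "(P * i' + v) mod m = r" "twist X' ((P * i' + v) div m) = T"
    using q(2) q'(2) m unfolding qq by (simp_all add: accepted_iff P_def v_def)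
  have "[P * i + v = P * i' + v] (mod m)"
    using a(1) a'(1) by (simp add: unique_euclidean_semiring_class.cong_def)
  then have "[P * i = P * i'] (mod m)"
    by (simp add: cong_add_rcancel_nat)
  then have "[P * i = P * i'] (mod k)"
    by (rule cong_dvd_modulus_nat) simp
  moreover have "coprime P k"
    using odd_k by (simp add: P_def)
  ultimately have "[i = i'] (mod k)"
    by (simp add: cong_mult_lcancel_nat)
  then have "i = i'"
    using i i' by (simp add: unique_euclidean_semiring_class.cong_def)
  moreover then have "X = X'" using a(2) a'(2) by (metis twist_inject)
  ultimately show ?thesis using qq by simp
qed

text \<open>Two consecutive integers \<open>2 * t\<close> and \<open>2 * t + 1\<close> lie on different sides of the Thue--Morse
  set, so one of them is the quotient of an accepted word.\<close>

lemma ex_long_accepted: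
  assumes "i < m"
  shows "\<exists>w \<in> accepted (i, X). z \<le> p * length w"
proof -
  \<comment> \<open>Words of length \<open>n\<close> realise exactly the values from
    \<open>P * i\<close> to \<open>P * i + P - 1\<close>. Both candidates
    \<open>m * (2 * t) + r\<close> and \<open>m * (2 * t + 1) + r\<close> exceed
    \<open>P * i\<close> by less than \<open>4 * m\<close>; the summand \<open>z\<close> makes the
    word long enough.\<close>
  define n where "n = 4 * m + z"
  define P :: nat where "P = 2 ^ (p * n)"
  have P: "4 * m < P" using exp_large[of n] by (simp add: P_def n_def)
  \<comment> \<open>\<open>2 * m * t\<close> is the least multiple of \<open>2 * m\<close> above
    \<open>P * i\<close>.\<close>
  define t where "t = P * i div (2 * m) + 1"
  have t1: "P * i < 2 * m * t"
    unfolding t_def using dividend_less_div_times[of "2 * m" "P * i"] m_pos by (simp add: algebra_simps)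
  have t2: "2 * m * t \<le> P * i + 2 * m"
    unfolding t_def using times_div_less_eq_dividend[of "2 * m" "P * i"]
    by (simp only: distrib_left mult_1_right add_le_cancel_right)
  obtain d where d: "d = 2 * t \<or> d = Suc (2 * t)" "twist X d = T"
    by (cases X; cases "t \<in> thue_morse")
      (metis twist_def double_in_thue_morse Suc_double_in_thue_morse opposite.simps)+
  have d1: "P * i \<le> m * d + r"
  proof -
    have "m * (2 * t) \<le> m * d" using d by (intro mult_left_mono) auto
    moreover have "m * (2 * t) = 2 * m * t" by (simp add: mult_ac)
    ultimately show ?thesis using t1 by linarith
  qed
  have d2: "m * d + r < P * i + P"
  proof -
    have "m * d \<le> m * Suc (2 * t)" using d by (intro mult_left_mono) auto
    also have "\<dots> = 2 * m * t + m" by (simp add: algebra_simps)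
    finally show ?thesis using t2 P r_less by linarith
  qed
  have "m * d + r - P * i < (2 ^ p) ^ n"
    using d1 d2 by (simp add: P_def power_mult)
  from ex_word[OF this] obtain w where w: "w \<in> lists (digits (2 ^ p))" "length w = n"
    "val (2 ^ p) w = m * d + r - P * i" by blast
  have eq: "P * i + val (2 ^ p) w = m * d + r" using w d1 by simp
  have "(m * d + r) mod m = r" "(m * d + r) div m = d"
    using r_less m_pos by (simp_all del: mult_pos_pos)
  then have "w \<in> accepted (i, X)"
    using w(1,2) eq d unfolding accepted_iff[OF assms] P_def by simp
  moreover have "z \<le> p * length w"
  proof -
    have "z \<le> n" by (simp add: n_def)
    also have "n \<le> p * n" using p_pos by simp
    finally show ?thesis using w(2) by simp
  qed
  ultimately show ?thesis by blast
qed

section \<open>Fibers of step \<open>k\<close> and their base points\<close>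

lemma fiber_subset_states:
  assumes "m = n * 2 ^ g" and "fst q < n"
  shows "fiber n g q \<subseteq> {..<m} \<times> UNIV"
proof -
  have "fst q + l * n < m" if "l < 2 ^ g" for l
  proof -
    have "fst q + l * n < Suc l * n" using assms by simp
    also have "\<dots> \<le> 2 ^ g * n" using that by (intro mult_right_mono) auto
    finally show ?thesis using assms by (simp add: mult.commute)
  qed
  then show ?thesis by (auto simp: fiber_def)
qed

text \<open>A long word accepted from \<open>u\<close> and \<open>u'\<close> is accepted from both
  base points as well, which therefore coincide.\<close>

lemma fiber_determined:
  assumes "fst q < k" and "fst q' < k" and "u \<in> fiber k z q" and "u' \<in> fiber k z q'"
    and same: "accepted u = accepted u'"
  shows "q = q'"
proof -
  obtain i X where u: "u = (i, X)" "i < m"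
    using fiber_subset_states[of k z q] assms by auto
  then obtain w where w: "w \<in> accepted u" "z \<le> p * length w"
    using ex_long_accepted by blast
  then have "w \<in> accepted q" "w \<in> accepted q'"
    using fiber_accepted[of k z q w u] fiber_accepted[of k z q' w u'] assms by auto
  then show ?thesis using accepted_common_word w assms by blast
qed

lemma ex_fiber:
  assumes "i < m"
  shows "\<exists>q. fst q < k \<and> (i, X) \<in> fiber k z q"
proof -
  define l where "l = i div k"
  have "l < 2 ^ z" using assms by (simp add: l_def less_mult_imp_div_less mult.commute)
  moreover have "i = i mod k + l * k" by (simp add: l_def)
  \<comment> \<open>Twisting twice by \<open>l\<close> is the identity, so the base point carries
    the letter \<open>twist X l\<close>.\<close>
  ultimately have "(i, X) \<in> fiber k z (i mod k, twist X l)"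
    by (auto simp: fiber_def intro!: exI[of _ l])
  then show ?thesis using k_pos by (intro exI[of _ "(i mod k, twist X l)"]) simp
qed

subsection \<open>The classes\<close>

lemma two_exp_m: "two_exp m = z"
proof -
  have "multiplicity 2 (k * 2 ^ z) = z"
    using odd_k by (subst multiplicity_prime_elem_times_other)
      (auto simp: not_dvd_imp_multiplicity_0 prime_elem_multiplicity_mult_distrib)
  then show ?thesis by (simp add: two_exp_def)
qed

lemma odd_part_m: "odd_part m = k"
  by (simp add: odd_part_def two_exp_m)

text \<open>The minimum merges the two cases of \<open>C_pre\<close>: each set has
  \<open>2 ^ level a\<close> elements, with step \<open>modulus a\<close>.\<close>

definition level :: "nat \<Rightarrow> nat" where
  "level a = min (p * a) z"

definition modulus :: "nat \<Rightarrow> nat" where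
  "modulus a = k * 2 ^ (z - level a)"

text \<open>The number left of \<open>r\<close> when its last \<open>a\<close> digits in base
  \<open>2 ^ p\<close> are dropped.\<close>

definition prefix :: "nat \<Rightarrow> nat" where
  "prefix a = r div 2 ^ (p * a)"

lemma m_eq: "m = modulus a * 2 ^ level a"
  by (simp add: modulus_def level_def mult.assoc flip: power_add)

lemma le_ratio_iff: "real a \<le> real z / real p \<longleftrightarrow> p * a \<le> z"
proof -
  have "real a \<le> real z / real p \<longleftrightarrow> real (p * a) \<le> real z"
    using p_pos by (simp add: field_simps)
  then show ?thesis by (simp only: of_nat_le_iff)
qed

lemma C_pre_fiber: "C_pre p m r a = fiber (modulus a) (level a) (prefix a, T)"
proof (cases "p * a \<le> z")
  case True
  then have "level a = p * a" by (simp add: level_def)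
  moreover have "m div 2 ^ (p * a) = modulus a" using m_eq[of a] calculation by simp
  ultimately show ?thesis
    using True by (simp add: C_pre_def two_exp_m le_ratio_iff fiber_def prefix_def)
next
  case False
  then have "level a = z" "modulus a = k" by (simp_all add: level_def modulus_def)
  then show ?thesis
    using False by (simp add: C_pre_def two_exp_m le_ratio_iff fiber_def prefix_def odd_part_m)
qed

lemma D_pre_fiber: "D_pre m q = fiber k z q"
  by (cases q) (simp add: D_pre_def fiber_def two_exp_m odd_part_m)

lemma prefix_less: "prefix a < modulus a"
proof -
  have "r < modulus a * 2 ^ (p * a)"
  proof -
    have "modulus a * 2 ^ level a \<le> modulus a * 2 ^ (p * a)"
      by (intro mult_left_mono power_increasing) (auto simp: level_def)
    then show ?thesis using r_less m_eq[of a] by linarith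
  qed
  then show ?thesis by (simp add: prefix_def less_mult_imp_div_less)
qed

lemma less_rep_len: "a < rep_len p r \<longleftrightarrow> prefix a > 0"
proof -
  have "(2::nat) ^ 1 \<le> 2 ^ p" using p_pos by (intro power_increasing) auto
  then have "a < rep_len p r \<longleftrightarrow> (2 ^ p) ^ a \<le> r"
    by (simp add: rep_len_def less_length_rep)
  then show ?thesis by (simp add: prefix_def div_greater_zero_iff power_mult)
qed

abbreviation "N \<equiv> max_index p m r"

lemma N_eq: "N = max (nat \<lceil>real z / real p\<rceil>) (rep_len p r)"
  by (simp add: max_index_def two_exp_m)

lemma nat_ceiling_le_iff: "nat \<lceil>real z / real p\<rceil> \<le> a \<longleftrightarrow> z \<le> p * a"
proof -
  have "nat \<lceil>real z / real p\<rceil> \<le> a \<longleftrightarrow> real z / real p \<le> real a"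
    by (simp add: nat_le_iff ceiling_le_iff)
  also have "\<dots> \<longleftrightarrow> real z \<le> real (p * a)"
    using p_pos by (simp add: field_simps)
  finally show ?thesis by (simp only: of_nat_le_iff)
qed

text \<open>Together with \<open>prefix_N\<close> this makes \<open>C_pre p m r N\<close> the fiber
  of \<open>(0, T)\<close>, the one pair left out of \<open>D_indices\<close>.\<close>

lemma z_le_pN: "z \<le> p * N"
  using nat_ceiling_le_iff[of N] by (simp add: N_eq)

lemma prefix_N: "prefix N = 0"
  using less_rep_len[of N] by (simp add: N_eq)

lemma C_pre_long: "z \<le> p * a \<Longrightarrow> C_pre p m r a = fiber k z (prefix a, T)"
  by (simp add: C_pre_fiber level_def modulus_def)

lemma prefix_less_k: "z \<le> p * a \<Longrightarrow> prefix a < k"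
  using prefix_less[of a] by (simp add: level_def modulus_def)

text \<open>The witness is the word of length \<open>a\<close> with value \<open>r mod P\<close>:
  from the first component \<open>prefix a\<close> it produces exactly \<open>r\<close>, with
  quotient 0. It is accepted from the whole fiber by \<open>fiber_accepted\<close>.\<close>

lemma C_pre_iff_accepted:
  assumes "p * a \<le> z" and "i < m"
  shows "(i, X) \<in> C_pre p m r a \<longleftrightarrow> (\<exists>w \<in> accepted (i, X). length w = a)"
proof
  define P :: nat where "P = 2 ^ (p * a)"
  have g: "level a = p * a" using assms by (simp add: level_def)
  have m: "m = modulus a * P" using m_eq[of a] by (simp add: g P_def)
  {
    assume C: "(i, X) \<in> C_pre p m r a"
    have "r mod P < (2 ^ p) ^ a" by (simp add: P_def power_mult)
    from ex_word[OF this] obtain w where w: "w \<in> lists (digits (2 ^ p))" "length w = a"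
      "val (2 ^ p) w = r mod P" by blast
    have "prefix a \<le> P * prefix a" by (simp add: P_def)
    moreover have "P * prefix a + r mod P = r" by (simp add: P_def prefix_def)
    ultimately have "prefix a < m" using r_less by linarith
    then have "w \<in> accepted (prefix a, T)"
      using w \<open>P * prefix a + r mod P = r\<close> r_less
      by (simp add: accepted_iff flip: P_def)
    then have "w \<in> accepted (i, X)"
      using fiber_accepted[OF m_eq[of a], of "(prefix a, T)" w "(i, X)"] C w prefix_less[of a]
      by (simp add: C_pre_fiber g)
    then show "\<exists>w \<in> accepted (i, X). length w = a" using w by blast
  next
    assume "\<exists>w \<in> accepted (i, X). length w = a"
    then obtain w where w: "w \<in> accepted (i, X)" "length w = a" by blast
    define v d where "v = val (2 ^ p) w" and "d = (P * i + v) div m"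
    have dig: "w \<in> lists (digits (2 ^ p))" and mod: "(P * i + v) mod m = r" and X: "twist X d = T"
      using w assms by (auto simp: accepted_iff P_def v_def d_def)
    have v: "v < P" using val_less[OF dig] w by (simp add: v_def P_def power_mult)
    have "P * i + v = m * d + r"
      using mult_div_mod_eq[of m "P * i + v"] mod by (simp add: d_def)
    \<comment> \<open>Since \<open>P\<close> divides \<open>m\<close>, division by \<open>P\<close>
      discards \<open>v\<close> and exhibits the quotient \<open>d\<close> as the index of
      \<open>(i, X)\<close> in the fiber.\<close>
    then have "(P * i + v) div P = (P * (modulus a * d) + r) div P" by (simp add: m algebra_simps)
    then have i: "i = modulus a * d + prefix a"
      using v by (simp add: prefix_def P_def)
    have "modulus a * d < modulus a * P" using i assms m by linarith
    then have "d < P" by simp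
    moreover have "X = twist T d" using X by (metis twist_twist_same)
    ultimately show "(i, X) \<in> C_pre p m r a"
      using i by (auto simp: C_pre_fiber fiber_def g P_def mult.commute)
  }
qed

lemma C_pre_subset_states: "C_pre p m r a \<subseteq> {..<m} \<times> UNIV"
  unfolding C_pre_fiber by (rule fiber_subset_states[OF m_eq]) (simp add: prefix_less)

lemma D_pre_subset_states: "q \<in> D_indices m \<Longrightarrow> D_pre m q \<subseteq> {..<m} \<times> UNIV"
  unfolding D_pre_fiber by (rule fiber_subset_states) (auto simp: D_indices_def odd_part_m)

lemma UN_C_class: "(\<Union>a \<le> b. C_class p m r a) = (\<Union>a \<le> b. C_pre p m r a)"
proof
  show "(\<Union>a \<le> b. C_class p m r a) \<subseteq> (\<Union>a \<le> b. C_pre p m r a)"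
    by (auto simp: C_class_def)
  show "(\<Union>a \<le> b. C_pre p m r a) \<subseteq> (\<Union>a \<le> b. C_class p m r a)"
  proof
    fix q assume "q \<in> (\<Union>a \<le> b. C_pre p m r a)"
    then obtain c where c: "c \<le> b" "q \<in> C_pre p m r c" by blast
    define a where "a = (LEAST a. q \<in> C_pre p m r a)"
    have "q \<in> C_pre p m r a" unfolding a_def using c(2) by (rule LeastI)
    moreover have "a \<le> c" unfolding a_def using c(2) by (rule Least_le)
    moreover have "q \<notin> C_pre p m r a'" if "a' < a" for a'
      using that not_less_Least unfolding a_def by blast
    ultimately show "q \<in> (\<Union>a \<le> b. C_class p m r a)"
      using c(1) by (auto simp: C_class_def)
  qed
qed

section \<open>The classes cover the state set\<close>

lemma classes_cases:
  assumes "J \<in> classes p m r"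
  obtains (C) a where "a \<le> N" "J = C_class p m r a"
  | (D) q where "q \<in> D_indices m" "J = D_class p m r q"
  using assms unfolding classes_def by blast

lemma Union_classes: "\<Union> (classes p m r) = {..<m} \<times> UNIV"
proof
  show "\<Union> (classes p m r) \<subseteq> {..<m} \<times> UNIV"
  proof
    fix u assume "u \<in> \<Union> (classes p m r)"
    then obtain J where J: "J \<in> classes p m r" "u \<in> J" by blast
    from J(1) show "u \<in> {..<m} \<times> UNIV"
    proof (cases rule: classes_cases)
      case C
      then show ?thesis using C_pre_subset_states J(2) by (auto simp: C_class_def)
    next
      case D
      then show ?thesis using D_pre_subset_states J(2) unfolding D_class_def by blast
    qed
  qed
  show "{..<m} \<times> UNIV \<subseteq> \<Union> (classes p m r)"
  proof
    fix u :: "nat \<times> letter" assume "u \<in> {..<m} \<times> UNIV"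
    then obtain q where q: "fst q < k" "u \<in> D_pre m q"
      using ex_fiber unfolding D_pre_fiber by (metis SigmaE lessThan_iff)
    show "u \<in> \<Union> (classes p m r)"
    proof (cases "u \<in> (\<Union>a \<le> N. C_class p m r a)")
      case True
      then show ?thesis unfolding classes_def by blast
    next
      case False
      \<comment> \<open>The set \<open>C_pre p m r N\<close> is the fiber of \<open>(0, T)\<close>,
        so a state outside all \<open>C_class\<close> sets has a base point in
        \<open>D_indices\<close>.\<close>
      have "u \<notin> fiber k z (0, T)"
        using False C_pre_long[OF z_le_pN] prefix_N unfolding UN_C_class by auto
      then have "q \<noteq> (0, T)" using q by (auto simp: D_pre_fiber)
      moreover have "snd q = T \<or> snd q = B" by (metis letter.exhaust)
      ultimately have "q \<in> D_indices m"
        using q by (cases q) (auto simp: D_indices_def odd_part_m)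
      moreover have "u \<in> D_class p m r q" using q False by (simp add: D_class_def)
      ultimately show ?thesis unfolding classes_def by blast
    qed
  qed
qed

text \<open>Words with \<open>b \<le> p * length w\<close> do not separate the fiber. A shorter word
  would be accepted only from a state in the \<open>C_pre\<close> set indexed by its length, and
  these sets are excluded.\<close>

lemma fiber_same_language:
  assumes "m = c * 2 ^ b" and "fst q < c" and "b \<le> z"
    and u: "u \<in> fiber c b q" "\<And>a. p * a < b \<Longrightarrow> u \<notin> C_pre p m r a"
    and u': "u' \<in> fiber c b q" "\<And>a. p * a < b \<Longrightarrow> u' \<notin> C_pre p m r a"
  shows "accepted u = accepted u'"
proof (rule set_eqI)
  fix w
  show "w \<in> accepted u \<longleftrightarrow> w \<in> accepted u'"
  proof (cases "b \<le> p * length w")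
    case True
    then show ?thesis using fiber_accepted assms by metis
  next
    case False
    have "w \<notin> accepted x" if "x \<in> fiber c b q" "\<And>a. p * a < b \<Longrightarrow> x \<notin> C_pre p m r a" for x
    proof -
      have "x \<in> {..<m} \<times> UNIV"
        using fiber_subset_states[OF assms(1,2)] that(1) by blast
      then obtain i X where x: "x = (i, X)" "i < m" by auto
      have "x \<notin> C_pre p m r (length w)" using that False by simp
      then show ?thesis
        using C_pre_iff_accepted[of "length w" i X] x False \<open>b \<le> z\<close> by auto
    qed
    then show ?thesis using u u' by blast
  qed
qed

lemma class_same_language:
  assumes "J \<in> classes p m r" and u: "u \<in> J" and u': "u' \<in> J"
  shows "accepted u = accepted u'"
  using assms(1)
proof (cases rule: classes_cases)
  case (C a)
  \<comment> \<open>The sets to be avoided have index below \<open>a\<close>, and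
    \<open>C_class\<close> removes precisely those.\<close>
  have "p * b < level a \<Longrightarrow> b < a" for b
    by (simp add: level_def)
  then have "x \<in> fiber (modulus a) (level a) (prefix a, T) \<and> (\<forall>b. p * b < level a \<longrightarrow> x \<notin> C_pre p m r b)"
    if "x \<in> J" for x
    using that C by (auto simp: C_class_def C_pre_fiber)
  then show ?thesis
    using fiber_same_language[OF m_eq[of a], of "(prefix a, T)" u u'] u u' prefix_less[of a]
    by (simp add: level_def)
next
  case (D q)
  \<comment> \<open>The sets to be avoided have index at most \<open>N\<close>, and
    \<open>D_class\<close> removes all of these.\<close>
  have "b \<le> N" if "p * b < z" for b
  proof -
    have "p * b < p * N" using that z_le_pN by linarith
    then show ?thesis by simp
  qed
  then have "x \<in> fiber k z q \<and> (\<forall>b. p * b < z \<longrightarrow> x \<notin> C_pre p m r b)"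
    if "x \<in> J" for x
    using that D unfolding D_class_def D_pre_fiber UN_C_class by auto
  moreover have "fst q < k" using D by (auto simp: D_indices_def odd_part_m)
  ultimately show ?thesis
    using fiber_same_language[of k z q u u'] u u' by simp
qed

text \<open>For \<open>p * a \<le> z\<close> membership means accepting some word of length
  \<open>a\<close>; for larger \<open>a\<close> it is decided by the base point, which the language
  determines.\<close>

lemma C_pre_same_language:
  assumes "accepted u = accepted u'" and "u \<in> {..<m} \<times> UNIV" and "u' \<in> {..<m} \<times> UNIV"
    and "u \<in> C_pre p m r a"
  shows "u' \<in> C_pre p m r a"
proof (cases "p * a \<le> z")
  case True
  then show ?thesis
    using C_pre_iff_accepted[OF True] assms by (metis SigmaE lessThan_iff)
next
  case False
  obtain q where q: "fst q < k" "u' \<in> fiber k z q"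
    using ex_fiber assms(3) by (metis SigmaE lessThan_iff)
  have "u \<in> fiber k z (prefix a, T)" using assms(4) False C_pre_long by simp
  then have "(prefix a, T) = q"
    using fiber_determined[of "(prefix a, T)" q u u'] q assms(1) prefix_less_k[of a] False by simp
  then show ?thesis using q False C_pre_long by simp
qed

text \<open>Both membership in the \<open>C_pre\<close> sets and the base point of step
  \<open>k\<close> depend only on the accepted language.\<close>

lemma class_same_language_mem:
  assumes J: "J \<in> classes p m r" and u: "u \<in> J" and u': "u' \<in> {..<m} \<times> UNIV"
    and same: "accepted u = accepted u'"
  shows "u' \<in> J"
proof -
  have u_state: "u \<in> {..<m} \<times> UNIV" using J u Union_classes by blast
  have C_iff: "u \<in> C_pre p m r a \<longleftrightarrow> u' \<in> C_pre p m r a" for a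
    using C_pre_same_language[of u u'] C_pre_same_language[of u' u] same u_state u' by metis
  from J show ?thesis
  proof (cases rule: classes_cases)
    case (C a)
    then show ?thesis using u C_iff by (auto simp: C_class_def)
  next
    case (D q)
    obtain q' where q': "fst q' < k" "u' \<in> fiber k z q'"
      using ex_fiber u' by (metis SigmaE lessThan_iff)
    have "fst q < k" "u \<in> fiber k z q"
      using D u by (auto simp: D_indices_def odd_part_m D_class_def D_pre_fiber)
    then have "q = q'" using fiber_determined q' same by blast
    then show ?thesis
      using D u q' C_iff unfolding D_class_def UN_C_class D_pre_fiber by auto
  qed
qed

lemma classes_disjoint:
  assumes J: "J \<in> classes p m r" "u \<in> J" and J': "J' \<in> classes p m r" "u \<in> J'"
  shows "J = J'"
proof -
  have CC: "a = b" if "u \<in> C_class p m r a" "u \<in> C_class p m r b" for a b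
    using that by (cases a b rule: linorder_cases) (auto simp: C_class_def)
  have CD: "u \<notin> D_class p m r q" if "a \<le> N" "u \<in> C_class p m r a" for a q
    using that by (auto simp: D_class_def)
  have DD: "q = q'" if "q \<in> D_indices m" "q' \<in> D_indices m"
      "u \<in> D_class p m r q" "u \<in> D_class p m r q'" for q q'
    using that fiber_determined[of q q' u u]
    by (auto simp: D_indices_def odd_part_m D_class_def D_pre_fiber)
  from J(1) J'(1) show ?thesis
    using J(2) J'(2) CC CD DD by (elim classes_cases) metis+
qed

text \<open>The element with \<open>l = 1\<close> is new: its letter is \<open>B\<close>, while its first component is too small for
  any \<open>l > 0\<close> at a lower level \<open>b\<close> with \<open>p * b < z\<close>. For \<open>level a = 0\<close> only \<open>l = 0\<close> is available.\<close>

lemma C_class_nonempty: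
  assumes "a \<le> N"
  shows "C_class p m r a \<noteq> {}"
proof -
  define l :: nat where "l = (if level a = 0 then 0 else 1)"
  define u where "u = (prefix a + l * modulus a, twist T l)"
  have "u \<in> C_pre p m r a"
  proof -
    have "l < 2 ^ level a" 
      using one_less_power[of "2::nat" "level a"] by (simp add: l_def)
    then show ?thesis unfolding C_pre_fiber fiber_def u_def by auto
  qed
  moreover have "u \<notin> C_pre p m r b" if b: "b < a" for b
  proof
    assume "u \<in> C_pre p m r b"
    then obtain l' where l': "prefix a + l * modulus a = prefix b + l' * modulus b" "twist T l = twist T l'"
      by (auto simp: C_pre_fiber fiber_def u_def)
    have pb: "p * b < p * a" using b p_pos by simp
    show False
    proof (cases "p * b < z")
      case True
      then have g: "level b < level a" "level a \<le> z" using pb by (auto simp: level_def)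
      then have l: "l = 1" by (simp add: l_def)
      have "2 * modulus a \<le> modulus b"
      proof -
        have "(2::nat) ^ Suc (z - level a) \<le> 2 ^ (z - level b)"
          using g by (intro power_increasing) auto
        then have "k * 2 ^ Suc (z - level a) \<le> k * 2 ^ (z - level b)" by (rule mult_left_mono) simp
        then show ?thesis by (simp add: modulus_def mult_ac)
      qed
      then have "prefix b + l' * modulus b < modulus b" using l' l prefix_less[of a] by simp
      then have "l' * modulus b < 1 * modulus b" by linarith
      then have "l' < 1" using mult_less_cancel2 by blast
      then show False using l'(2) l by simp
    next
      case False
      \<comment> \<open>Both sets now have step \<open>k\<close>, so reducing a common element
        modulo \<open>k\<close> yields \<open>prefix a = prefix b\<close>.\<close>
      then have "z \<le> p * a" "z \<le> p * b" using pb by linarith+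
      then have "level a = z" "level b = z" "modulus a = k" "modulus b = k"
        by (simp_all add: level_def modulus_def)
      then have "(prefix a + l * k) mod k = (prefix b + l' * k) mod k" and "prefix a < k" "prefix b < k"
        using l' prefix_less[of a] prefix_less[of b] by auto
      then have eq: "prefix a = prefix b" by simp
      \<comment> \<open>The ceiling lies below \<open>a \<le> N\<close>, so \<open>N\<close> equals
        \<open>rep_len p r\<close> and \<open>b\<close> is smaller than it. Hence
        \<open>prefix b\<close> is positive, and dropping further digits strictly decreases
        it.\<close>
      have "nat \<lceil>real z / real p\<rceil> < a" using False b nat_ceiling_le_iff[of b] by linarith
      then have "b < rep_len p r" using assms b by (simp add: N_eq)
      then have pos: "prefix b > 0" by (simp add: less_rep_len)
      have "(2::nat) ^ 0 < 2 ^ (p * a - p * b)"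
        using pb by (intro power_strict_increasing) auto
      moreover have "prefix a = prefix b div 2 ^ (p * a - p * b)"
      proof -
        have "(2::nat) ^ (p * a) = 2 ^ (p * b) * 2 ^ (p * a - p * b)"
          using pb by (simp flip: power_add)
        then show ?thesis unfolding prefix_def by (simp only: div_mult2_eq)
      qed
      ultimately have "prefix a < prefix b" using pos by simp
      then show False using eq by simp
    qed
  qed
  ultimately show ?thesis unfolding C_class_def by blast
qed

section \<open>The final class, the initial class and the quotient structure\<close>

lemma C_class_0: "C_class p m r 0 = {(r, T)}"
  by (auto simp: C_class_def C_pre_fiber fiber_def level_def prefix_def)

text \<open>All first components in \<open>C_pre p m r b\<close> are at least
  \<open>prefix b\<close>, which first vanishes at \<open>b = rep_len p r\<close>.\<close>

lemma initial_in_C_class: "(0, T) \<in> C_class p m r (rep_len p r)"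
proof -
  have "prefix (rep_len p r) = 0" using less_rep_len[of "rep_len p r"] by simp
  then have "(0, T) \<in> C_pre p m r (rep_len p r)"
    by (auto simp: C_pre_fiber fiber_def intro!: exI[of _ 0])
  moreover have "(0, T) \<notin> C_pre p m r b" if "b < rep_len p r" for b
    using that by (auto simp: C_pre_fiber fiber_def less_rep_len)
  ultimately show ?thesis by (auto simp: C_class_def)
qed

lemma M_aut_quotient: "nerode_quotient (Pi_aut p m r) (M_aut p m r)"
proof unfold_locales
  have states: "states (M_aut p m r) = classes p m r" by (simp add: M_aut_def)
  show "dfa (Pi_aut p m r)" by (rule dfa_Pi)
  show "complete_automaton (Pi_aut p m r)" by (rule complete_Pi)
  show "accessible (Pi_aut p m r)" by (rule accessible_Pi)
  show "J \<noteq> {}" if "J \<in> states (M_aut p m r)" for J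
    using that C_class_nonempty unfolding states classes_def by blast
  show cover: "\<Union> (states (M_aut p m r)) = states (Pi_aut p m r)"
    unfolding states states_Pi by (rule Union_classes)
  show "accepted q = accepted q'" if "J \<in> states (M_aut p m r)" "q \<in> J" "q' \<in> J" for J q q'
    using that class_same_language unfolding states by blast
  show "J = J'" if "J \<in> states (M_aut p m r)" "J' \<in> states (M_aut p m r)" "q \<in> J" "q' \<in> J'"
      "accepted q = accepted q'" for J J' q q'
  proof -
    \<comment> \<open>Classes are closed under equality of languages, so \<open>q'\<close> lies in
      \<open>J\<close> as well as in \<open>J'\<close>, and disjointness applies.\<close>
    have "q' \<in> J"
      using that class_same_language_mem[of J q q'] Union_classes unfolding states by blast
    then show ?thesis using that classes_disjoint[of J q' J'] unfolding states by blast
  qed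
  show "alphabet (M_aut p m r) = alphabet (Pi_aut p m r)" by (simp add: M_aut_def Pi_aut_def)
  show "initial (M_aut p m r) \<in> states (M_aut p m r)"
    by (auto simp: M_aut_def classes_def N_eq)
  show "initial (Pi_aut p m r) \<in> initial (M_aut p m r)"
    using initial_in_C_class by (simp add: M_aut_def Pi_aut_def)
  have C0: "C_class p m r 0 \<in> classes p m r" unfolding classes_def by blast
  \<comment> \<open>By disjointness the class of \<open>(r, T)\<close> is the only one that meets
    the final states of the product.\<close>
  have "{J \<in> classes p m r. (r, T) \<in> J} = {C_class p m r 0}"
  proof -
    have "(r, T) \<in> C_class p m r 0" by (simp add: C_class_0)
    then show ?thesis using C0 classes_disjoint[OF C0] by blast
  qed
  moreover have "finals (M_aut p m r) = {C_class p m r 0}" by (simp add: M_aut_def)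
  moreover have "finals (Pi_aut p m r) = {(r, T)}" by (simp add: Pi_aut_def)
  moreover have "J \<inter> {(r, T)} \<noteq> {} \<longleftrightarrow> (r, T) \<in> J" for J by blast
  ultimately show "finals (M_aut p m r) = {J \<in> states (M_aut p m r). J \<inter> finals (Pi_aut p m r) \<noteq> {}}"
    unfolding states by (simp only:)
  show "transitions (M_aut p m r) = {(J1, a, J2) | J1 a J2.
        J1 \<in> states (M_aut p m r) \<and> J2 \<in> states (M_aut p m r) \<and> a \<in> alphabet (Pi_aut p m r) \<and>
        (\<exists>q1 \<in> J1. \<exists>q2 \<in> J2. (q1, a, q2) \<in> transitions (Pi_aut p m r))}"
  proof -
    have "alphabet (Pi_aut p m r) = digits (2 ^ p)" by (simp add: Pi_aut_def)
    then show ?thesis unfolding M_aut_def by (simp only: automaton.select_convs)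
  qed
qed

end

theorem theorem46:
  fixes p m r :: nat
  assumes "p > 0" and "m > 0" and "r \<in> {0..m - 1}"
  shows "minimal_automaton_of (M_aut p m r)
           (val_preimage (2 ^ p) ((\<lambda>t. m * t + r) ` thue_morse))"
proof -
  obtain k where k: "m = 2 ^ multiplicity 2 m * k" "\<not> 2 dvd k"
    using assms(2) multiplicity_decompose'[of m 2] by auto
  define z where "z = multiplicity 2 m"
  have m: "m = k * 2 ^ z" using k by (simp add: z_def mult.commute)
  have "r < m" using assms(2,3) by auto
  interpret thue_morse_multiple p k z r
    using assms(1) k(2) \<open>r < m\<close> unfolding m by unfold_locales
  interpret nerode_quotient "Pi_aut p (k * 2 ^ z) r" "M_aut p (k * 2 ^ z) r"
    by (rule M_aut_quotient)
  show ?thesis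
    unfolding m language_Pi[symmetric] by (rule minimal_automaton_of_quotient)
qed

end
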